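(* Let $a$ be a bounded operator on a Hilbert space. Then $$\left\Vert e^{a}\right\Vert \leq\left\Vert e^{\mathrm{Re}(a)}\right\Vert .$$
   Context: $\mathrm{Re}(a)=\tfrac12(a+a^{*})$ and $\|\cdot\|$ is the operator norm. *)

theory Defs
  imports "HOL-Analysis.Analysis"
begin

text \<open>
  Complex Hilbert spaces. The inner product is conjugate-linear in its first argument and linear
  in its second. Building on \<^class>\<open>real_normed_vector\<close> makes the metric and the topology
  those of the norm, and the norm is required to be the one induced by the inner product.
\<close>

class complex_inner = real_normed_vector +
  fixes scaleC :: "complex \<Rightarrow> 'a \<Rightarrow> 'a" (infixr "*\<^sub>C" 75)
    and cinner :: "'a \<Rightarrow> 'a \<Rightarrow> complex"
  assumes scaleC_add_right: "c *\<^sub>C (x + y) = c *\<^sub>C x + c *\<^sub>C y"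
    and scaleC_add_left: "(c + d) *\<^sub>C x = c *\<^sub>C x + d *\<^sub>C x"
    and scaleC_scaleC: "c *\<^sub>C d *\<^sub>C x = (c * d) *\<^sub>C x"
    and scaleR_scaleC: "r *\<^sub>R x = complex_of_real r *\<^sub>C x"
    and cinner_commute: "cinner x y = cnj (cinner y x)"
    and cinner_add_left: "cinner (x + y) z = cinner x z + cinner y z"
    and cinner_scaleC_left: "cinner (c *\<^sub>C x) y = cnj c * cinner x y"
    and cinner_ge_zero: "0 \<le> Re (cinner x x)"
    and cinner_eq_zero_iff: "cinner x x = 0 \<longleftrightarrow> x = 0"
    and norm_eq_sqrt_cinner: "norm x = sqrt (Re (cinner x x))"

class complex_hilbert_space = complex_inner + complete_space
begin

subclass banach ..

end

lemma vector_space_scaleC: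
  "vector_space (scaleC :: complex \<Rightarrow> 'a \<Rightarrow> 'a::complex_inner)"
proof
  show "1 *\<^sub>C x = x" for x :: 'a
    using scaleR_scaleC[of 1 x] by simp
qed (simp_all add: scaleC_add_right scaleC_add_left scaleC_scaleC)

instantiation complex :: complex_hilbert_space
begin

definition scaleC_complex :: "complex \<Rightarrow> complex \<Rightarrow> complex"
  where "scaleC_complex c x = c * x"

definition cinner_complex :: "complex \<Rightarrow> complex \<Rightarrow> complex"
  where "cinner_complex x y = cnj x * y"

instance
  by standard
    (auto simp: scaleC_complex_def cinner_complex_def algebra_simps scaleR_conv_of_real
       cmod_def power2_eq_square)

end

text \<open>
  Elements of \<^typ>\<open>'a \<Rightarrow>\<^sub>L 'b\<close> are bounded \<^emph>\<open>real\<close>-linear maps, with the operator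
  norm as \<^const>\<open>norm\<close>; the bounded operators on a complex space are those that are also
  complex-linear.
\<close>

abbreviation clinear :: "('a::complex_inner \<Rightarrow> 'b::complex_inner) \<Rightarrow> bool"
  where "clinear \<equiv> Vector_Spaces.linear scaleC scaleC"

text \<open>
  By Riesz representation the adjoint below exists, and is unique, when the operator is
  complex-linear; otherwise no operator satisfies the condition and the value is unspecified.
\<close>

definition adj :: "('a::complex_hilbert_space \<Rightarrow>\<^sub>L 'a) \<Rightarrow> ('a \<Rightarrow>\<^sub>L 'a)"
  where "adj a = (THE b. \<forall>x y. cinner (blinfun_apply b x) y = cinner x (blinfun_apply a y))"

definition op_Re :: "('a::complex_hilbert_space \<Rightarrow>\<^sub>L 'a) \<Rightarrow> ('a \<Rightarrow>\<^sub>L 'a)"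
  where "op_Re a = (1 / 2) *\<^sub>R (a + adj a)"

text \<open>
  The library's \<^const>\<open>exp\<close> needs a unital normed algebra with norm \<open>1\<close> unit, which the operators
  on the zero space do not form, so the exponential series is written out; it converges in
  operator norm.
\<close>

definition op_exp :: "('a::complex_hilbert_space \<Rightarrow>\<^sub>L 'a) \<Rightarrow> ('a \<Rightarrow>\<^sub>L 'a)"
  where "op_exp a = (\<Sum>n. (((o\<^sub>L) a ^^ n) id_blinfun) /\<^sub>R fact n)"

end

theory Submission imports Defs begin

text \<open>
  Write \<open>h\<close> for the real part of \<open>a\<close>; then \<open>Re \<langle>x, a x\<rangle> = \<langle>x, h x\<rangle>\<close>. If \<open>\<langle>x, h x\<rangle> \<le> M \<parallel>x\<parallel>\<^sup>2\<close> for all \<open>x\<close>,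
  then \<open>\<parallel>e\<^sup>-\<^sup>M\<^sup>t e\<^sup>t\<^sup>a x\<parallel>\<^sup>2\<close> has nonpositive derivative in \<open>t\<close>, so \<open>\<parallel>e\<^sup>a\<parallel> \<le> e\<^sup>M\<close>. It remains to see that
  \<open>M = ln \<parallel>e\<^sup>h\<parallel>\<close> is admissible, i.e. that \<open>e\<^sup>m \<le> \<parallel>e\<^sup>h x\<parallel>\<close> for a unit vector \<open>x\<close> and \<open>m = \<langle>x, h x\<rangle>\<close>.
  With \<open>z t = e\<^sup>-\<^sup>m\<^sup>t e\<^sup>t\<^sup>h x\<close> and the self-adjoint \<open>k = h - m\<close>, the function \<open>\<parallel>z t\<parallel>\<^sup>2\<close> has second
  derivative \<open>4 \<parallel>k (z t)\<parallel>\<^sup>2 \<ge> 0\<close> and its first derivative vanishes at \<open>0\<close>, so \<open>\<parallel>z 1\<parallel> \<ge> \<parallel>z 0\<parallel> = 1\<close>.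
\<close>

section \<open>The real inner product underlying the complex one\<close>

lemma Re_cinner_commute: "Re (cinner x y) = Re (cinner y x)"
  by (subst cinner_commute) simp

lemma power2_norm_eq_cinner: "(norm x)\<^sup>2 = Re (cinner x x)"
  by (simp add: norm_eq_sqrt_cinner cinner_ge_zero)

text \<open>Stated as the class predicate, this makes the theorems on \<open>real_inner\<close>,
  notably Cauchy-Schwarz, available for the real part of \<open>cinner\<close>.\<close>

lemma Re_cinner_real_inner:
  "class.real_inner (-) dist norm (+) 0 uminus (*\<^sub>R) sgn uniformity open
    (\<lambda>x y :: 'a::complex_inner. Re (cinner x y))"
proof
  show "Re (cinner x x) = 0 \<longleftrightarrow> x = 0" for x :: 'a
    by (metis norm_eq_zero power2_norm_eq_cinner power_zero_numeral zero_eq_power2)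
qed (simp_all add: Re_cinner_commute cinner_add_left scaleR_scaleC cinner_scaleC_left
    cinner_ge_zero norm_eq_sqrt_cinner)

lemmas Re_cinner_le_norm = real_inner.norm_cauchy_schwarz[OF Re_cinner_real_inner]

interpretation Re_cinner: bounded_bilinear "\<lambda>x y :: 'a::complex_inner. Re (cinner x y)"
proof
  show "\<exists>K. \<forall>x y :: 'a. norm (Re (cinner x y)) \<le> norm x * norm y * K"
    by (auto intro!: exI[of _ 1] simp: real_inner.Cauchy_Schwarz_ineq2[OF Re_cinner_real_inner])
qed (simp_all add: real_inner.inner_add_left[OF Re_cinner_real_inner]
    real_inner.inner_add_right[OF Re_cinner_real_inner]
    real_inner.inner_scaleR_left[OF Re_cinner_real_inner]
    real_inner.inner_scaleR_right[OF Re_cinner_real_inner])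

section \<open>Riesz representation and the adjoint\<close>

text \<open>
  The representing vector is the minimizer of \<open>\<parallel>u\<parallel>\<^sup>2 - 2 \<phi> u\<close>: the parallelogram law makes every
  minimizing sequence Cauchy.
\<close>

lemma Riesz_representation:
  fixes \<phi> :: "'a::complex_hilbert_space \<Rightarrow> real"
  assumes "bounded_linear \<phi>"
  obtains u where "\<And>v. Re (cinner u v) = \<phi> v"
proof -
  interpret \<phi>: bounded_linear \<phi> by fact
  define Q where "Q u = (norm u)\<^sup>2 - 2 * \<phi> u" for u
  define I where "I = Inf (range Q)"
  obtain K where K: "\<And>x. norm (\<phi> x) \<le> norm x * K"
    using \<phi>.bounded by blast
  \<comment> \<open>Completing the square: \<open>Q u\<close> is at least
    \<open>(norm u - K)\<^sup>2 - K\<^sup>2\<close>.\<close>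
  have "- K\<^sup>2 \<le> Q u" for u
  proof -
    have "\<phi> u \<le> norm u * K"
      using K[of u] by simp
    moreover have "0 \<le> (norm u - K)\<^sup>2"
      by simp
    ultimately show ?thesis
      by (simp add: Q_def power2_diff)
  qed
  then have "bdd_below (range Q)"
    by (auto simp: bdd_below_def)
  then have I_le: "I \<le> Q u" for u
    unfolding I_def by (simp add: cInf_lower)
  have "\<exists>u. Q u < I + 1 / Suc n" for n :: nat
    using cInf_lessD[of "range Q" "I + 1 / Suc n"] by (force simp: I_def)
  then obtain u where u: "\<And>n::nat. Q (u n) < I + 1 / Suc n"
    by metis
  have parallelogram: "(norm (x - y))\<^sup>2 \<le> 2 * (Q x + Q y - 2 * I)" for x y
  proof -
    have "4 * Q ((1/2) *\<^sub>R (x + y)) = Re (cinner (x + y) (x + y)) - 4 * \<phi> (x + y)"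
      unfolding Q_def power2_norm_eq_cinner
      by (simp add: Re_cinner.scaleR_left Re_cinner.scaleR_right \<phi>.scaleR)
    then have "(norm (x - y))\<^sup>2 = 2 * (Q x + Q y - 2 * Q ((1/2) *\<^sub>R (x + y)))"
      by (simp add: Q_def[of x] Q_def[of y] power2_norm_eq_cinner Re_cinner.add_left
          Re_cinner.add_right Re_cinner.diff_left Re_cinner.diff_right \<phi>.add
          Re_cinner_commute[of y x])
    then show ?thesis
      using I_le[of "(1/2) *\<^sub>R (x + y)"] by simp
  qed
  have "Cauchy u"
  proof (rule CauchyI)
    fix e :: real
    assume "0 < e"
    \<comment> \<open>Two excesses over \<open>I\<close> below \<open>e\<^sup>2 / 4\<close>, doubled
      by \<open>parallelogram\<close>, stay below \<open>e\<^sup>2\<close>.\<close>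
    then have "0 < e\<^sup>2 / 4" by simp
    then obtain N :: nat where N: "1 / Suc N < e\<^sup>2 / 4"
      by (metis nat_approx_posE)
    have near_I: "Q (u n) < I + e\<^sup>2 / 4" if "n \<ge> N" for n
    proof -
      have "1 / Suc n \<le> 1 / Suc N"
        using that by (simp add: frac_le)
      with N have "I + 1 / Suc n < I + e\<^sup>2 / 4"
        by (intro add_strict_left_mono) (rule le_less_trans)
      with u[of n] show ?thesis
        by (rule less_trans)
    qed
    have "norm (u m - u n) < e" if "m \<ge> N" "n \<ge> N" for m n
    proof -
      have "(norm (u m - u n))\<^sup>2 < e\<^sup>2"
        using parallelogram[of "u m" "u n"] near_I[OF that(1)] near_I[OF that(2)] by argo
      then show ?thesis
        using \<open>0 < e\<close> by (simp add: power2_less_imp_less)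
    qed
    then show "\<exists>N. \<forall>m\<ge>N. \<forall>n\<ge>N. norm (u m - u n) < e"
      by blast
  qed
  then obtain w where w: "u \<longlonglongrightarrow> w"
    using Cauchy_convergent convergent_def by blast
  have "(\<lambda>n. Q (u n)) \<longlonglongrightarrow> Q w"
    unfolding Q_def by (intro tendsto_intros \<phi>.tendsto w)
  moreover have "(\<lambda>n. I + 1 / Suc n) \<longlonglongrightarrow> I + 0"
    by (intro tendsto_intros LIMSEQ_Suc lim_1_over_n)
  ultimately have "Q w \<le> I + 0"
    using u by (intro LIMSEQ_le) (auto intro: less_imp_le)
  then have Q_min: "Q w \<le> Q v" for v
    using I_le[of v] by simp
  have "Re (cinner w v) = \<phi> v" for v
  proof (rule ccontr)
    define c where "c = Re (cinner w v) - \<phi> v"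
    assume "Re (cinner w v) \<noteq> \<phi> v"
    then have "c \<noteq> 0" by (simp add: c_def)
    then have "v \<noteq> 0"
      by (auto simp: c_def Re_cinner.zero_right \<phi>.zero)
    have "Q (w + t *\<^sub>R v) = Q w + 2 * t * c + t\<^sup>2 * (norm v)\<^sup>2" for t
      unfolding Q_def power2_norm_eq_cinner c_def
      by (simp add: Re_cinner.add_left Re_cinner.add_right Re_cinner.scaleR_left Re_cinner.scaleR_right
          \<phi>.add \<phi>.scaleR Re_cinner_commute[of v w] power2_eq_square algebra_simps)
    \<comment> \<open>This \<open>t\<close> minimizes the quadratic polynomial in
      \<open>t\<close>.\<close>
    from this[of "- c / (norm v)\<^sup>2"]
    have "Q (w + (- c / (norm v)\<^sup>2) *\<^sub>R v) = Q w - c\<^sup>2 / (norm v)\<^sup>2"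
      using \<open>v \<noteq> 0\<close> by (simp add: power2_eq_square)
    moreover have "0 < c\<^sup>2 / (norm v)\<^sup>2"
      using \<open>c \<noteq> 0\<close> \<open>v \<noteq> 0\<close> by simp
    ultimately show False
      using Q_min[of "w + (- c / (norm v)\<^sup>2) *\<^sub>R v"] by simp
  qed
  then show thesis ..
qed

text \<open>The imaginary part of a form linear in \<open>v\<close> is minus its real part at
  \<open>\<i> *\<^sub>C v\<close>, so real parts determine it.\<close>

lemma cinner_eqI_Re:
  fixes a :: "'a::complex_inner \<Rightarrow> 'a"
  assumes "clinear a" and "\<And>v. Re (cinner u v) = Re (cinner x (a v))"
  shows "cinner u v = cinner x (a v)"
proof (rule complex_eqI)
  have right: "cinner x (c *\<^sub>C y) = c * cinner x y" for c and x y :: 'a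
    by (metis cinner_commute cinner_scaleC_left complex_cnj_cnj complex_cnj_mult)
  have "a (\<i> *\<^sub>C v) = \<i> *\<^sub>C a v"
    using assms(1) by (simp add: Vector_Spaces.linear_iff_module_hom module_hom.scale)
  then show "Im (cinner u v) = Im (cinner x (a v))"
    using assms(2)[of "\<i> *\<^sub>C v"] by (simp add: right)
qed (rule assms(2))

text \<open>Unfolding the definite description needs existence and uniqueness: Riesz gives the
  adjoint pointwise, and nondegeneracy gives its linearity and uniqueness.\<close>

lemma cinner_adj:
  fixes a :: "'a::complex_hilbert_space \<Rightarrow>\<^sub>L 'a"
  assumes "clinear (blinfun_apply a)"
  shows "cinner (blinfun_apply (adj a) x) y = cinner x (blinfun_apply a y)"
proof -
  have "\<exists>u. \<forall>v. Re (cinner u v) = Re (cinner x (blinfun_apply a v))" for x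
  proof -
    have "bounded_linear (\<lambda>v. Re (cinner x (blinfun_apply a v)))"
      by (intro bounded_linear_intros Re_cinner.bounded_linear_right[THEN bounded_linear_compose])
    then show ?thesis
      by (metis Riesz_representation)
  qed
  then obtain f where f: "\<And>x v. Re (cinner (f x) v) = Re (cinner x (blinfun_apply a v))"
    by metis
  have eqI: "u = u'" if "\<And>v. Re (cinner u v) = Re (cinner u' v)" for u u' :: 'a
  proof -
    have "(norm (u - u'))\<^sup>2 = 0"
      unfolding power2_norm_eq_cinner using that[of "u - u'"] by (simp add: Re_cinner.diff_left)
    then show ?thesis by simp
  qed
  have "bounded_linear f"
  proof (rule bounded_linear_intro)
    show "f (x + y) = f x + f y" for x y
      by (rule eqI) (simp add: f Re_cinner.add_left)
    show "f (r *\<^sub>R x) = r *\<^sub>R f x" for r x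
      by (rule eqI) (simp add: f Re_cinner.scaleR_left)
    \<comment> \<open>Test the identity for \<open>f x\<close> at \<open>v = f x\<close> and cancel
      one factor \<open>norm (f x)\<close>.\<close>
    show "norm (f x) \<le> norm x * norm a" for x
    proof (cases "f x = 0")
      case False
      have "(norm (f x))\<^sup>2 = Re (cinner x (blinfun_apply a (f x)))"
        by (simp add: power2_norm_eq_cinner f)
      also have "\<dots> \<le> norm x * norm (blinfun_apply a (f x))"
        by (rule Re_cinner_le_norm)
      also have "\<dots> \<le> norm x * (norm a * norm (f x))"
        by (intro mult_left_mono norm_blinfun) auto
      finally show ?thesis
        using False by (simp add: power2_eq_square mult.assoc[symmetric])
    qed auto
  qed
  then have Blinfun_f: "blinfun_apply (Blinfun f) = f"
    by (rule bounded_linear_Blinfun_apply)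
  have "\<forall>x y. cinner (blinfun_apply (adj a) x) y = cinner x (blinfun_apply a y)"
    unfolding adj_def
  proof (rule theI[where a = "Blinfun f"], intro allI)
    show "cinner (blinfun_apply (Blinfun f) x) y = cinner x (blinfun_apply a y)" for x y
      unfolding Blinfun_f using assms f by (rule cinner_eqI_Re)
    show "b = Blinfun f"
      if "\<forall>x y. cinner (blinfun_apply b x) y = cinner x (blinfun_apply a y)" for b
    proof (rule blinfun_eqI)
      show "blinfun_apply b x = blinfun_apply (Blinfun f) x" for x
        by (rule eqI) (simp only: that Blinfun_f f)
    qed
  qed
  then show ?thesis by blast
qed

section \<open>The exponential series and its derivative\<close>

lemma has_vector_derivative_op_exp:
  fixes a :: "'a::complex_hilbert_space \<Rightarrow>\<^sub>L 'a"
  shows "((\<lambda>t. op_exp (t *\<^sub>R a)) has_vector_derivative (a o\<^sub>L op_exp (t *\<^sub>R a))) (at t)"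
proof -
  define P where "P n = ((o\<^sub>L) a ^^ n) id_blinfun" for n
  define f where "f n t = (t ^ n / fact n) *\<^sub>R P n" for n t
  \<comment> \<open>At \<open>n = 0\<close> the exponent truncates to \<open>0\<close>, but the
    factor \<open>real n\<close> makes the term vanish.\<close>
  define f' where "f' n t = (real n * t ^ (n - 1) / fact n) *\<^sub>R P n" for n t
  define R where "R = \<bar>t\<bar> + 1"
  have R: "R \<ge> 1" by (simp add: R_def)
  have P_Suc: "P (Suc n) = a o\<^sub>L P n" for n
    by (simp add: P_def)
  have P_norm: "norm (P n) \<le> norm a ^ n" for n
  proof (induction n)
    case (Suc n)
    have "norm (P (Suc n)) \<le> norm a * norm (P n)"
      unfolding P_Suc by (rule norm_blinfun_compose)
    also have "\<dots> \<le> norm a * norm a ^ n"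
      by (intro mult_left_mono Suc) simp
    finally show ?case by simp
  qed (simp add: P_def norm_blinfun_id_le)
  have "((o\<^sub>L) (s *\<^sub>R a) ^^ n) id_blinfun = s ^ n *\<^sub>R P n" for n s
    by (induction n)
      (simp_all add: P_def bounded_bilinear.scaleR_left[OF bounded_bilinear_blinfun_compose]
        bounded_bilinear.scaleR_right[OF bounded_bilinear_blinfun_compose])
  then have op_exp_eq: "op_exp (s *\<^sub>R a) = (\<Sum>n. f n s)" for s
    by (simp add: op_exp_def f_def divide_inverse mult.commute)
  \<comment> \<open>The factor \<open>n\<close> is absorbed by \<open>2 ^ n\<close>, and
    \<open>R \<ge> 1\<close> raises the exponent \<open>n - 1\<close> to \<open>n\<close>; the
    majorant is again an exponential series.\<close>
  have f'_bound: "norm (f' n s) \<le> (2 * R * norm a) ^ n /\<^sub>R fact n" if "s \<in> ball t 1" for n s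
  proof -
    have "\<bar>s\<bar> \<le> R"
      using that by (auto simp: dist_real_def R_def)
    then have "\<bar>s\<bar> ^ (n - 1) \<le> R ^ (n - 1)"
      by (intro power_mono) auto
    also have "\<dots> \<le> R ^ n"
      using R by (intro power_increasing) auto
    finally have "real n * \<bar>s\<bar> ^ (n - 1) * norm (P n) \<le> 2 ^ n * R ^ n * norm a ^ n"
      using R P_norm of_nat_less_two_power[of n, where 'a = real]
      by (intro mult_mono) auto
    then show ?thesis
      by (simp add: f'_def power_mult_distrib power_abs abs_mult divide_simps)
  qed
  have f'_limit: "uniform_limit (ball t 1) (\<lambda>n s. \<Sum>i<n. f' i s) (\<lambda>s. \<Sum>i. f' i s) sequentially"
    by (rule Weierstrass_m_test[OF f'_bound summable_exp_generic])
  have f_summable: "summable (\<lambda>n. f n s)" for s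
  proof (rule summable_comparison_test'[OF summable_exp_generic])
    show "norm (f n s) \<le> (\<bar>s\<bar> * norm a) ^ n /\<^sub>R fact n" for n
      using P_norm[of n] by (simp add: f_def power_mult_distrib power_abs divide_simps mult_left_mono)
  qed
  \<comment> \<open>Termwise differentiation yields some sum function \<open>g\<close>; uniqueness
    of sums later identifies it with the exponential near \<open>t\<close>.\<close>
  have "\<exists>g. \<forall>s\<in>ball t 1. (\<lambda>n. f n s) sums g s \<and>
      (g has_derivative (\<lambda>h. h *\<^sub>R (\<Sum>n. f' n s))) (at s within ball t 1)"
  proof (rule has_derivative_series[where f' = "\<lambda>n s h. h *\<^sub>R f' n s"])
    show "(f n has_derivative (\<lambda>h. h *\<^sub>R f' n s)) (at s within ball t 1)" for n s
      unfolding f_def f'_def by (auto intro!: derivative_eq_intros)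
    fix e :: real
    assume "e > 0"
    then show "\<forall>\<^sub>F n in sequentially. \<forall>s\<in>ball t 1. \<forall>h.
        norm ((\<Sum>i<n. h *\<^sub>R f' i s) - h *\<^sub>R (\<Sum>n. f' n s)) \<le> e * norm h"
      using uniform_limitD[OF f'_limit \<open>e > 0\<close>]
      by (elim eventually_mono)
        (auto simp: dist_norm mult.commute[of e] intro!: mult_left_mono intro: less_imp_le
          simp flip: scaleR_sum_right scaleR_diff_right)
  qed (use f_summable[of t] in \<open>auto simp: summable_sums\<close>)
  then obtain g where g: "\<And>s. s \<in> ball t 1 \<Longrightarrow> (\<lambda>n. f n s) sums g s"
    and g': "(g has_vector_derivative (\<Sum>n. f' n t)) (at t within ball t 1)"
    unfolding has_vector_derivative_def by (metis centre_in_ball zero_less_one)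
  have f'_Suc: "f' (Suc n) s = a o\<^sub>L f n s" for n s
    by (simp add: f_def f'_def P_Suc bounded_bilinear.scaleR_right[OF bounded_bilinear_blinfun_compose]
        field_simps del: of_nat_Suc)
  have "(\<lambda>n. a o\<^sub>L f n t) sums (a o\<^sub>L op_exp (t *\<^sub>R a))"
    unfolding op_exp_eq
    by (intro bounded_linear.sums[OF bounded_bilinear.bounded_linear_right[OF bounded_bilinear_blinfun_compose]]
        summable_sums f_summable)
  then have "(\<lambda>n. f' (Suc n) t) sums (a o\<^sub>L op_exp (t *\<^sub>R a))"
    by (simp only: f'_Suc)
  \<comment> \<open>Undoing the index shift adds only the zero term \<open>f' 0 t\<close>.\<close>
  from sums_Suc[OF this] have "(\<lambda>n. f' n t) sums (a o\<^sub>L op_exp (t *\<^sub>R a))"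
    by (simp add: f'_def)
  then have "(\<Sum>n. f' n t) = a o\<^sub>L op_exp (t *\<^sub>R a)"
    by (rule sums_unique[symmetric])
  with g' have "(g has_vector_derivative (a o\<^sub>L op_exp (t *\<^sub>R a))) (at t)"
    by (simp only: at_within_open[OF centre_in_ball[THEN iffD2, OF zero_less_one] open_ball])
  moreover have "g s = op_exp (s *\<^sub>R a)" if "s \<in> ball t 1" for s
    unfolding op_exp_eq using g[OF that] by (rule sums_unique)
  ultimately show ?thesis
    using has_vector_derivative_transform_within_open[of g _ t "ball t 1"] by simp
qed

lemma op_exp_0: "op_exp (0 :: 'a::complex_hilbert_space \<Rightarrow>\<^sub>L 'a) = id_blinfun"
proof -
  have "((o\<^sub>L) (0 :: 'a \<Rightarrow>\<^sub>L 'a) ^^ n) id_blinfun = 0" if "n \<noteq> 0" for n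
    using that by (cases n)
      (simp_all add: bounded_bilinear.zero_left[OF bounded_bilinear_blinfun_compose]
        del: blinfun_compose_zero)
  then show ?thesis
    unfolding op_exp_def by (subst suminf_finite[of "{0}"]) auto
qed

text \<open>By the product rule, the scalar factor shifts the generator from \<open>a\<close> to
  \<open>a - m\<close>.\<close>

lemma has_vector_derivative_rescaled_op_exp:
  fixes a :: "'a::complex_hilbert_space \<Rightarrow>\<^sub>L 'a"
  defines "z x m t \<equiv> exp (- m * t) *\<^sub>R blinfun_apply (op_exp (t *\<^sub>R a)) x"
  shows "(z x m has_vector_derivative (blinfun_apply (a - m *\<^sub>R id_blinfun) (z x m t))) (at t)"
proof -
  have "((\<lambda>t. blinfun_apply (op_exp (t *\<^sub>R a)) x) has_vector_derivative
      blinfun_apply a (blinfun_apply (op_exp (t *\<^sub>R a)) x)) (at t)"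
    using bounded_linear.has_vector_derivative[OF blinfun.bounded_linear_left has_vector_derivative_op_exp]
    by simp
  then show ?thesis
    unfolding z_def
    by (auto intro!: derivative_eq_intros simp: blinfun.bilinear_simps scaleR_diff_right)
qed

section \<open>Upper and lower bounds from the numerical range\<close>

lemma norm_op_exp_le:
  fixes a :: "'a::complex_hilbert_space \<Rightarrow>\<^sub>L 'a"
  assumes "\<And>x. Re (cinner x (blinfun_apply a x)) \<le> M * (norm x)\<^sup>2"
  shows "norm (op_exp a) \<le> exp M"
proof (rule norm_blinfun_bound)
  fix x
  define k where "k = a - M *\<^sub>R id_blinfun"
  define z where "z t = exp (- M * t) *\<^sub>R blinfun_apply (op_exp (t *\<^sub>R a)) x" for t
  have z': "(z has_vector_derivative (blinfun_apply k (z t))) (at t)" for t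
    unfolding z_def k_def by (rule has_vector_derivative_rescaled_op_exp)
  have F': "((\<lambda>t. (norm (z t))\<^sup>2) has_real_derivative 2 * Re (cinner (z t) (blinfun_apply k (z t)))) (at t)" for t
    unfolding power2_norm_eq_cinner has_real_derivative_iff_has_vector_derivative
    using Re_cinner.has_vector_derivative[OF z' z'] by (simp add: Re_cinner_commute)
  have "2 * Re (cinner y (blinfun_apply k y)) \<le> 0" for y
    using assms[of y]
    by (simp add: k_def blinfun.bilinear_simps Re_cinner.diff_right Re_cinner.scaleR_right power2_norm_eq_cinner)
  with F' have "\<exists>y. ((\<lambda>t. (norm (z t))\<^sup>2) has_real_derivative y) (at t) \<and> y \<le> 0" for t
    by blast
  then have "(norm (z 1))\<^sup>2 \<le> (norm (z 0))\<^sup>2"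
    by (rule DERIV_nonpos_imp_nonincreasing[OF zero_le_one])
  then have "norm (z 1) \<le> norm (z 0)"
    by (rule power2_le_imp_le) simp
  then show "norm (blinfun_apply (op_exp a) x) \<le> exp M * norm x"
    by (simp add: z_def op_exp_0 exp_minus field_simps)
qed simp

text \<open>In terms of the spectral measure of \<open>h\<close> at \<open>x\<close> this is
  Jensen's inequality; convexity of \<open>(norm (z t))\<^sup>2\<close> in \<open>t\<close> gives it
  without spectral theory.\<close>

lemma exp_numerical_range_le:
  fixes h :: "'a::complex_hilbert_space \<Rightarrow>\<^sub>L 'a"
  assumes h: "\<And>x y. Re (cinner (blinfun_apply h x) y) = Re (cinner x (blinfun_apply h y))"
    and "norm x = 1"
  shows "exp (Re (cinner x (blinfun_apply h x))) \<le> norm (op_exp h)"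
proof -
  define m where "m = Re (cinner x (blinfun_apply h x))"
  define k where "k = h - m *\<^sub>R id_blinfun"
  define z where "z t = exp (- m * t) *\<^sub>R blinfun_apply (op_exp (t *\<^sub>R h)) x" for t
  have k: "Re (cinner (blinfun_apply k x) y) = Re (cinner x (blinfun_apply k y))" for x y
    by (simp add: k_def blinfun.bilinear_simps h Re_cinner.diff_left Re_cinner.diff_right
        Re_cinner.scaleR_left Re_cinner.scaleR_right)
  have z': "(z has_vector_derivative (blinfun_apply k (z t))) (at t)" for t
    unfolding z_def k_def by (rule has_vector_derivative_rescaled_op_exp)
  have kz': "((\<lambda>t. blinfun_apply k (z t)) has_vector_derivative (blinfun_apply k (blinfun_apply k (z t)))) (at t)" for t
    by (rule bounded_linear.has_vector_derivative[OF blinfun.bounded_linear_right z'])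
  define G where "G t = 2 * Re (cinner (z t) (blinfun_apply k (z t)))" for t
  have F': "((\<lambda>t. (norm (z t))\<^sup>2) has_real_derivative G t) (at t)" for t
    unfolding power2_norm_eq_cinner has_real_derivative_iff_has_vector_derivative G_def
    using Re_cinner.has_vector_derivative[OF z' z'] by (simp add: Re_cinner_commute)
  \<comment> \<open>Symmetry of \<open>k\<close> makes both summands of the product rule equal to
    the squared norm of \<open>k (z t)\<close>.\<close>
  have "((\<lambda>t. Re (cinner (z t) (blinfun_apply k (z t)))) has_real_derivative
      2 * (norm (blinfun_apply k (z t)))\<^sup>2) (at t)" for t
    unfolding has_real_derivative_iff_has_vector_derivative
    using Re_cinner.has_vector_derivative[OF z' kz'] by (simp add: k[symmetric] power2_norm_eq_cinner)
  then have G': "(G has_real_derivative 4 * (norm (blinfun_apply k (z t)))\<^sup>2) (at t)" for t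
    unfolding G_def using DERIV_cmult[where c = 2] by fastforce
  have [simp]: "z 0 = x"
    by (simp add: z_def op_exp_0)
  \<comment> \<open>The shift \<open>m\<close> was chosen for this:
    \<open>\<langle>x, k x\<rangle> = m - m * (norm x)\<^sup>2\<close> and
    \<open>norm x = 1\<close>.\<close>
  have "G 0 = 0"
    using \<open>norm x = 1\<close> power2_norm_eq_cinner[of x]
    by (simp add: G_def k_def blinfun.bilinear_simps Re_cinner.diff_right Re_cinner.scaleR_right m_def)
  have "\<exists>y. (G has_real_derivative y) (at t) \<and> 0 \<le> y" for t
    using G'[of t] zero_le_power2[of "norm (blinfun_apply k (z t))"] by force
  with \<open>G 0 = 0\<close> have "0 \<le> G t" if "0 \<le> t" for t
    using DERIV_nonneg_imp_nondecreasing[OF that, of G] by metis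
  with F' have "\<exists>y. ((\<lambda>t. (norm (z t))\<^sup>2) has_real_derivative y) (at t) \<and> 0 \<le> y" if "0 \<le> t" for t
    using that by blast
  then have "(norm (z 0))\<^sup>2 \<le> (norm (z 1))\<^sup>2"
    by (rule DERIV_nonneg_imp_nondecreasing[OF zero_le_one])
  then have "norm (z 0) \<le> norm (z 1)"
    by (rule power2_le_imp_le) simp
  then have "1 \<le> norm (z 1)"
    using \<open>norm x = 1\<close> by simp
  then have "exp m \<le> norm (blinfun_apply (op_exp h) x)"
    by (simp add: z_def exp_minus field_simps)
  also have "\<dots> \<le> norm (op_exp h)"
    using norm_blinfun[of "op_exp h" x] \<open>norm x = 1\<close> by simp
  finally show ?thesis
    by (simp add: m_def)
qed

section \<open>Combining the two bounds\<close>

theorem corollary5p1: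
  fixes a :: "'a::complex_hilbert_space \<Rightarrow>\<^sub>L 'a"
  assumes "clinear (blinfun_apply a)"
  shows "norm (op_exp a) \<le> norm (op_exp (op_Re a))"
proof (cases "\<exists>x::'a. x \<noteq> 0")
  case False
  then have "op_exp a = 0"
    by (intro blinfun_eqI) auto
  then show ?thesis by simp
next
  case True
  have op_Re: "blinfun_apply (op_Re a) x = (1/2) *\<^sub>R (blinfun_apply a x + blinfun_apply (adj a) x)" for x
    by (simp add: op_Re_def blinfun.bilinear_simps)
  have adj: "Re (cinner (blinfun_apply (adj a) x) y) = Re (cinner x (blinfun_apply a y))"
    "Re (cinner x (blinfun_apply (adj a) y)) = Re (cinner (blinfun_apply a x) y)" for x y
    using cinner_adj[OF assms] by (metis Re_cinner_commute)+
  have self_adj: "Re (cinner (blinfun_apply (op_Re a) x) y) = Re (cinner x (blinfun_apply (op_Re a) y))" for x y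
    by (simp add: op_Re Re_cinner.add_left Re_cinner.add_right Re_cinner.scaleR_left Re_cinner.scaleR_right adj)
  have numerical_range: "Re (cinner x (blinfun_apply (op_Re a) x)) = Re (cinner x (blinfun_apply a x))" for x
    by (simp add: op_Re Re_cinner.add_right Re_cinner.scaleR_right adj Re_cinner_commute[of "blinfun_apply a x"])
  define M where "M = ln (norm (op_exp (op_Re a)))"
  from True obtain e :: 'a where "norm e = 1"
    by (metis norm_sgn)
  \<comment> \<open>The lower bound at the unit vector \<open>e\<close> is an exponential, hence
    positive; thus \<open>exp M\<close> is exactly this norm.\<close>
  then have pos: "0 < norm (op_exp (op_Re a))"
    by (metis exp_gt_zero exp_numerical_range_le less_le_trans self_adj)
  have "Re (cinner x (blinfun_apply a x)) \<le> M * (norm x)\<^sup>2" for x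
  proof (cases "x = 0")
    case False
    \<comment> \<open>Normalize \<open>x\<close> to \<open>sgn x\<close>; the quadratic form scales
      back by \<open>(norm x)\<^sup>2\<close>.\<close>
    have "exp (Re (cinner (sgn x) (blinfun_apply a (sgn x)))) \<le> norm (op_exp (op_Re a))"
      using exp_numerical_range_le[OF self_adj] False by (metis norm_sgn numerical_range)
    then have "Re (cinner (sgn x) (blinfun_apply a (sgn x))) \<le> M"
      using pos by (simp add: M_def ln_ge_iff)
    then show ?thesis
      using False
      by (simp add: sgn_div_norm blinfun.bilinear_simps Re_cinner.scaleR_left Re_cinner.scaleR_right
          field_simps power2_eq_square)
  qed (simp add: Re_cinner.zero_left)
  then have "norm (op_exp a) \<le> exp M"
    by (rule norm_op_exp_le)
  then show ?thesis
    using pos by (simp add: M_def)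
qed

end
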